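(* Let $U_1=\{L(\alpha)\in CE(\mu_6): b_{1,1}\neq 0,\ b_{1,4}\neq 0\}$, and for $\alpha=(b_{0,0},b_{0,1},b_{1,1},b_{1,2},b_{1,4})$ put $\Delta=b_{0,1}^2-4b_{0,0}b_{1,1}$ (and $\Delta'=b_{0,1}'^2-4b_{0,0}'b_{1,1}'$ for $\alpha'$). (1) Two algebras $L(\alpha)$ and $L(\alpha')$ from $U_1$ are isomorphic if and only if $$\left(\frac{b_{1,4}}{b_{1,1}}\right)^8\Delta^3=\left(\frac{b_{1,4}'}{b_{1,1}'}\right)^8\Delta'^3.$$ (2) For any $\lambda\in\mathbb{C}$ there exists $L(\alpha)\in U_1$ with $\left(\frac{b_{1,4}}{b_{1,1}}\right)^8\Delta^3=\lambda$. Then the algebras from $U_1$ can be parameterized as $L(\lambda,0,1,0,1)$, $\lambda\in\mathbb{C}$; that is, every algebra in $U_1$ is isomorphic to $L(\lambda,0,1,0,1)$ for some $\lambda\in\mathbb{C}$.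
   Context: A Leibniz algebra over $\mathbb{C}$ is a complex vector space with a bilinear bracket satisfying $[x,[y,z]]=[[x,y],z]-[[x,z],y]$. $CE(\mu_6)$ (one-dimensional Leibniz central extensions of the 6-dimensional naturally graded filiform Lie algebra $\mu_6$) is the class of the 7-dimensional complex Leibniz algebras $L(\alpha)$, $\alpha=(b_{0,0},b_{0,1},b_{1,1},b_{1,2},b_{1,4})\in\mathbb{C}^5$, with basis $e_0,\dots,e_6$ and brackets $[e_i,e_0]=e_{i+1}$ ($1\le i\le 5$), $[e_0,e_i]=-e_{i+1}$ ($2\le i\le 5$), $[e_0,e_0]=b_{0,0}e_6$, $[e_0,e_1]=-e_2+b_{0,1}e_6$, $[e_1,e_1]=b_{1,1}e_6$, $[e_1,e_2]=-[e_2,e_1]=b_{1,2}e_6$, $[e_1,e_4]=-[e_4,e_1]=b_{1,4}e_6$, $[e_2,e_3]=-[e_3,e_2]=-b_{1,4}e_6$, all other brackets of basis vectors being zero. Isomorphic means isomorphic as Leibniz algebras. *)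

theory Defs
  imports "HOL-Analysis.Analysis"
begin

locale leibniz_algebra = vector_space scale
  for scale :: "complex \<Rightarrow> 'a::ab_group_add \<Rightarrow> 'a" +
  fixes bracket :: "'a \<Rightarrow> 'a \<Rightarrow> 'a"
  assumes linear_bracket_left: "Vector_Spaces.linear scale scale (\<lambda>x. bracket x y)"
    and linear_bracket_right: "Vector_Spaces.linear scale scale (\<lambda>y. bracket x y)"
    and leibniz_identity:
      "bracket x (bracket y z) = bracket (bracket x y) z - bracket (bracket x z) y"

definition leibniz_isomorphic ::
  "(complex \<Rightarrow> 'a::ab_group_add \<Rightarrow> 'a) \<Rightarrow> ('a \<Rightarrow> 'a \<Rightarrow> 'a) \<Rightarrow>
   (complex \<Rightarrow> 'b::ab_group_add \<Rightarrow> 'b) \<Rightarrow> ('b \<Rightarrow> 'b \<Rightarrow> 'b) \<Rightarrow> bool" where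
  "leibniz_isomorphic s1 br1 s2 br2 \<longleftrightarrow>
     leibniz_algebra s1 br1 \<and> leibniz_algebra s2 br2 \<and>
     (\<exists>f. Vector_Spaces.linear s1 s2 f \<and> bij f \<and>
          (\<forall>x y. f (br1 x y) = br2 (f x) (f y)))"

datatype ce_param =
  CE_Param (b00: complex) (b01: complex) (b11: complex) (b12: complex) (b14: complex)

text \<open>The underlying space of every algebra of the family is \<open>complex^7\<close> with its
  standard basis \<open>e 0, \<dots>, e 6\<close>; the index type \<open>7\<close> is \<open>{0..6}\<close> with
  arithmetic modulo 7.  An algebra of the family is represented by its bracket.\<close>

definition e :: "nat \<Rightarrow> complex^7" where
  "e i = axis (of_nat i) 1"

definition basis_bracket :: "ce_param \<Rightarrow> nat \<Rightarrow> nat \<Rightarrow> complex^7" where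
  "basis_bracket \<alpha> i j =
    (if j = 0 \<and> 1 \<le> i \<and> i \<le> 5 then e (i + 1)
     else if i = 0 \<and> 2 \<le> j \<and> j \<le> 5 then - e (j + 1)
     else if i = 0 \<and> j = 0 then b00 \<alpha> *s e 6
     else if i = 0 \<and> j = 1 then - e 2 + b01 \<alpha> *s e 6
     else if i = 1 \<and> j = 1 then b11 \<alpha> *s e 6
     else if i = 1 \<and> j = 2 then b12 \<alpha> *s e 6
     else if i = 2 \<and> j = 1 then - (b12 \<alpha> *s e 6)
     else if i = 1 \<and> j = 4 then b14 \<alpha> *s e 6
     else if i = 4 \<and> j = 1 then - (b14 \<alpha> *s e 6)
     else if i = 2 \<and> j = 3 then - (b14 \<alpha> *s e 6)
     else if i = 3 \<and> j = 2 then b14 \<alpha> *s e 6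
     else 0)"

definition L :: "ce_param \<Rightarrow> complex^7 \<Rightarrow> complex^7 \<Rightarrow> complex^7" where
  "L \<alpha> x y = (\<Sum>i<7. \<Sum>j<7. (x $ of_nat i * y $ of_nat j) *s basis_bracket \<alpha> i j)"

definition CE_mu6 :: "(complex^7 \<Rightarrow> complex^7 \<Rightarrow> complex^7) set" where
  "CE_mu6 = range L"

definition U1 :: "(complex^7 \<Rightarrow> complex^7 \<Rightarrow> complex^7) set" where
  "U1 = {L \<alpha> | \<alpha>. L \<alpha> \<in> CE_mu6 \<and> b11 \<alpha> \<noteq> 0 \<and> b14 \<alpha> \<noteq> 0}"

definition Delta :: "ce_param \<Rightarrow> complex" where
  "Delta \<alpha> = (b01 \<alpha>)\<^sup>2 - 4 * b00 \<alpha> * b11 \<alpha>"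

abbreviation isomorphic7 ::
  "(complex^7 \<Rightarrow> complex^7 \<Rightarrow> complex^7) \<Rightarrow> (complex^7 \<Rightarrow> complex^7 \<Rightarrow> complex^7) \<Rightarrow> bool"
  (infix "\<simeq>\<^sub>L" 50) where
  "A \<simeq>\<^sub>L B \<equiv> leibniz_isomorphic (*s) A (*s) B"

lemma exhaust_7: "(k::7) \<in> {0,1,2,3,4,5,6}"
proof (cases k)
  case (of_int z)
  then have "z = 0 \<or> z = 1 \<or> z = 2 \<or> z = 3 \<or> z = 4 \<or> z = 5 \<or> z = 6" by auto
  then show ?thesis using of_int by auto
qed

lemma forall_7: "(\<forall>k::7. P k) \<longleftrightarrow> P 0 \<and> P 1 \<and> P 2 \<and> P 3 \<and> P 4 \<and> P 5 \<and> P 6"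
  using exhaust_7 by (metis empty_iff insert_iff)

lemma L_components:
  "L \<alpha> x y $ 0 = 0"
  "L \<alpha> x y $ 1 = 0"
  "L \<alpha> x y $ 2 = x$1 * y$0 - x$0 * y$1"
  "L \<alpha> x y $ 3 = x$2 * y$0 - x$0 * y$2"
  "L \<alpha> x y $ 4 = x$3 * y$0 - x$0 * y$3"
  "L \<alpha> x y $ 5 = x$4 * y$0 - x$0 * y$4"
  "L \<alpha> x y $ 6 = x$5 * y$0 - x$0 * y$5 + b00 \<alpha> * x$0 * y$0 + b01 \<alpha> * x$0 * y$1
     + b11 \<alpha> * x$1 * y$1 + b12 \<alpha> * (x$1 * y$2 - x$2 * y$1)
     + b14 \<alpha> * (x$1 * y$4 - x$4 * y$1 - x$2 * y$3 + x$3 * y$2)"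
proof -
  have *: "sum f {..<7} = f 0 + f 1 + f 2 + f 3 + f 4 + f 5 + f 6" for f :: "nat \<Rightarrow> complex^7"
    by (simp add: lessThan_nat_numeral add_ac)
  show
    "L \<alpha> x y $ 0 = 0"
    "L \<alpha> x y $ 1 = 0"
    "L \<alpha> x y $ 2 = x$1 * y$0 - x$0 * y$1"
    "L \<alpha> x y $ 3 = x$2 * y$0 - x$0 * y$2"
    "L \<alpha> x y $ 4 = x$3 * y$0 - x$0 * y$3"
    "L \<alpha> x y $ 5 = x$4 * y$0 - x$0 * y$4"
    "L \<alpha> x y $ 6 = x$5 * y$0 - x$0 * y$5 + b00 \<alpha> * x$0 * y$0 + b01 \<alpha> * x$0 * y$1
       + b11 \<alpha> * x$1 * y$1 + b12 \<alpha> * (x$1 * y$2 - x$2 * y$1)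
       + b14 \<alpha> * (x$1 * y$4 - x$4 * y$1 - x$2 * y$3 + x$3 * y$2)"
    unfolding L_def * basis_bracket_def
    by (simp_all add: e_def axis_def algebra_simps)
qed

lemma vec_eq_7: "(x::complex^7) = y \<longleftrightarrow> x$0=y$0 \<and> x$1=y$1 \<and> x$2=y$2 \<and> x$3=y$3 \<and> x$4=y$4 \<and> x$5=y$5 \<and> x$6=y$6"
  by (simp add: vec_eq_iff forall_7)

lemma leibniz_algebra_L: "leibniz_algebra (*s) (L \<alpha>)"
  by unfold_locales (simp_all add: vec_eq_7 L_components algebra_simps)

lemma L_basis:
  assumes "i < 7" "j < 7"
  shows "L \<alpha> (e i) (e j) = basis_bracket \<alpha> i j"
proof -
  have "i \<in> {0,1,2,3,4,5,6}" "j \<in> {0,1,2,3,4,5,6}" using assms by auto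
  then show ?thesis
    unfolding insert_iff empty_iff vec_eq_7 L_components
    by (elim disjE FalseE; hypsubst; simp add: e_def axis_def basis_bracket_def)
qed

lemma L_inj: "L \<alpha> = L \<beta> \<longleftrightarrow> \<alpha> = \<beta>"
proof
  assume "L \<alpha> = L \<beta>"
  then have *: "L \<alpha> (e i) (e j) $ 6 = L \<beta> (e i) (e j) $ 6" for i j by simp
  show "\<alpha> = \<beta>"
    using *[of 0 0] *[of 0 1] *[of 1 1] *[of 1 2] *[of 1 4]
    by (cases \<alpha>; cases \<beta>) (simp add: L_components e_def axis_def)
qed simp

lemma L_in_U1_iff: "L \<alpha> \<in> U1 \<longleftrightarrow> b11 \<alpha> \<noteq> 0 \<and> b14 \<alpha> \<noteq> 0"
  by (auto simp: U1_def CE_mu6_def L_inj)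

end

theory Submission
  imports Defs
begin

text \<open>An isomorphism is determined by the images \<open>x\<close>, \<open>y\<close> of the generators \<open>e\<^sub>0\<close>, \<open>e\<^sub>1\<close>.
  Bijectivity and \<open>[e\<^sub>1,e\<^sub>2] \<in> \<complex> e\<^sub>6\<close> force \<open>y\<^sub>0 = 0\<close> and \<open>x\<^sub>0, y\<^sub>1 \<noteq> 0\<close>. Writing \<open>b\<close>, \<open>c\<close> for the
  parameters of the source and the target, comparing the \<open>e\<^sub>6\<close>-coordinates gives
  \<open>b\<^sub>0\<^sub>0 y\<^sub>1 x\<^sub>0\<^sup>5 = c\<^sub>0\<^sub>0 x\<^sub>0\<^sup>2 + c\<^sub>0\<^sub>1 x\<^sub>0 x\<^sub>1 + c\<^sub>1\<^sub>1 x\<^sub>1\<^sup>2\<close>, \<open>b\<^sub>0\<^sub>1 x\<^sub>0\<^sup>5 = c\<^sub>0\<^sub>1 x\<^sub>0 + 2 c\<^sub>1\<^sub>1 x\<^sub>1\<close>,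
  \<open>b\<^sub>1\<^sub>1 x\<^sub>0\<^sup>5 = c\<^sub>1\<^sub>1 y\<^sub>1\<close> and \<open>b\<^sub>1\<^sub>4 x\<^sub>0\<^sup>2 = c\<^sub>1\<^sub>4 y\<^sub>1\<close>. Hence \<open>b\<^sub>1\<^sub>4 / b\<^sub>1\<^sub>1 = x\<^sub>0\<^sup>3 c\<^sub>1\<^sub>4 / c\<^sub>1\<^sub>1\<close> and the two
  discriminants differ by the factor \<open>x\<^sub>0\<^sup>8\<close>, which yields the invariant. Conversely, equal invariants
  allow one to solve for \<open>x\<^sub>0\<close> (unique up to a cube root of unity, which adjusts
  \<open>x\<^sub>0\<^sup>8\<close>), then for \<open>y\<^sub>1\<close>, \<open>x\<^sub>1\<close> and finally \<open>y\<^sub>3\<close>, which absorbs \<open>b\<^sub>1\<^sub>2\<close>.\<close>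

lemma L_isomorphic_imp_relations:
  assumes "L \<alpha> \<simeq>\<^sub>L L \<beta>"
  obtains x0 x1 y1 where "x0 \<noteq> 0" "y1 \<noteq> 0"
    "b00 \<alpha> * (y1 * x0 ^ 5) = b00 \<beta> * x0\<^sup>2 + b01 \<beta> * x0 * x1 + b11 \<beta> * x1\<^sup>2"
    "b01 \<alpha> * x0 ^ 5 = b01 \<beta> * x0 + 2 * b11 \<beta> * x1"
    "b11 \<alpha> * x0 ^ 5 = b11 \<beta> * y1"
    "b14 \<alpha> * x0\<^sup>2 = b14 \<beta> * y1"
proof -
  obtain f where lin: "Vector_Spaces.linear (*s) (*s) f" and bij: "bij f"
    and hom: "\<And>u v. f (L \<alpha> u v) = L \<beta> (f u) (f v)"
    using assms unfolding leibniz_isomorphic_def by blast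
  interpret f: Vector_Spaces.linear "(*s)" "(*s)" f by (rule lin)
  define x y where "x = f (e 0)" and "y = f (e 1)"
  have f2: "f (e 2) = L \<beta> y x" and f3: "f (e 3) = L \<beta> (f (e 2)) x"
    and f4: "f (e 4) = L \<beta> (f (e 3)) x" and f5: "f (e 5) = L \<beta> (f (e 4)) x"
    and f6: "f (e 6) = L \<beta> (f (e 5)) x"
    and f00: "b00 \<alpha> *s f (e 6) = L \<beta> x x"
    and f01: "- f (e 2) + b01 \<alpha> *s f (e 6) = L \<beta> x y"
    and f11: "b11 \<alpha> *s f (e 6) = L \<beta> y y"
    and f12: "b12 \<alpha> *s f (e 6) = L \<beta> y (f (e 2))"
    and f14: "b14 \<alpha> *s f (e 6) = L \<beta> y (f (e 4))"
    unfolding x_def y_def hom[symmetric]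
    by (simp_all add: L_basis basis_bracket_def f.scale f.diff flip: numeral_2_eq_2)
  define d where "d = y$1 * x$0 - y$0 * x$1"
  have f6_0: "f (e 6) $ 0 = 0" "f (e 6) $ 1 = 0" "f (e 6) $ 2 = 0" "f (e 6) $ 3 = 0"
      "f (e 6) $ 4 = 0" "f (e 6) $ 5 = 0"
    and f6_6: "f (e 6) $ 6 = d * x$0 ^ 4"
    unfolding d_def
    by (simp_all add: f6 f5 f4 f3 f2 L_components power4_eq_xxxx algebra_simps)
  \<comment> \<open>As \<open>f (e 6)\<close> is concentrated in coordinate 6, injectivity of
    \<open>f\<close> makes \<open>d * x$0 ^ 4\<close> nonzero.\<close>
  have "e 6 \<noteq> 0"
    by (simp add: e_def)
  then have "f (e 6) \<noteq> 0"
    using bij f.zero by (metis bij_pointE)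
  then have "d * x$0 ^ 4 \<noteq> 0"
    using f6_0 f6_6 by (auto simp: vec_eq_7)
  then have d: "d \<noteq> 0" and x0: "x$0 \<noteq> 0" by auto
  have "y$0 * d = 0"
    using arg_cong[OF f12, of "\<lambda>v. v$3"] f6_0 by (simp add: L_components f2 d_def)
  then have y0: "y$0 = 0" using d by simp
  then have d_eq: "d = y$1 * x$0" and y1: "y$1 \<noteq> 0" using d by (auto simp: d_def)
  have f6_6: "f (e 6) $ 6 = y$1 * x$0 ^ 5"
    using f6_6 by (simp add: d_eq eval_nat_numeral)
  show thesis
  proof
    show "x$0 \<noteq> 0" "y$1 \<noteq> 0" by fact+
    show "b00 \<alpha> * (y$1 * x$0 ^ 5) = b00 \<beta> * (x$0)\<^sup>2 + b01 \<beta> * x$0 * x$1 + b11 \<beta> * (x$1)\<^sup>2"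
      using arg_cong[OF f00, of "\<lambda>v. v$6"]
      by (simp add: f6_6 L_components power2_eq_square algebra_simps)
    have "y$1 * (b01 \<alpha> * x$0 ^ 5) = y$1 * (b01 \<beta> * x$0 + 2 * b11 \<beta> * x$1)"
      using arg_cong[OF f01, of "\<lambda>v. v$6"]
      by (simp add: f6_6 f2 L_components y0 algebra_simps)
    then show "b01 \<alpha> * x$0 ^ 5 = b01 \<beta> * x$0 + 2 * b11 \<beta> * x$1"
      using y1 by simp
    have "y$1 * (b11 \<alpha> * x$0 ^ 5) = y$1 * (b11 \<beta> * y$1)"
      using arg_cong[OF f11, of "\<lambda>v. v$6"]
      by (simp add: f6_6 L_components y0 algebra_simps)
    then show "b11 \<alpha> * x$0 ^ 5 = b11 \<beta> * y$1"
      using y1 by simp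
    have "b14 \<alpha> * (y$1 * x$0 ^ 5) = b14 \<beta> * y$1 * (y$1 * x$0 ^ 3)"
      using arg_cong[OF f14, of "\<lambda>v. v$6"]
      by (simp add: f6_6 f4 f3 f2 L_components y0 power3_eq_cube)
    then have "y$1 * x$0 ^ 3 * (b14 \<alpha> * (x$0)\<^sup>2) = y$1 * x$0 ^ 3 * (b14 \<beta> * y$1)"
      by (simp add: eval_nat_numeral)
    then show "b14 \<alpha> * (x$0)\<^sup>2 = b14 \<beta> * y$1"
      using y1 x0 by simp
  qed
qed

text \<open>The map sends \<open>e 0\<close> to \<open>x0 e 0 + x1 e 1\<close> and
  \<open>e 1\<close> to \<open>y1 e 1 + y3 e 3\<close>. The term in \<open>e 3\<close> contributes
  twice to the image of \<open>[e 1, e 2]\<close>, through \<open>[e 1, e 4]\<close> and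
  \<open>[e 3, e 2]\<close>; hence \<open>2 * b14 \<beta> * y3\<close>.\<close>

lemma L_isomorphic_if_relations:
  assumes "x0 \<noteq> 0" "y1 \<noteq> 0"
    and r00: "b00 \<alpha> * (y1 * x0 ^ 5) = b00 \<beta> * x0\<^sup>2 + b01 \<beta> * x0 * x1 + b11 \<beta> * x1\<^sup>2"
    and r01: "b01 \<alpha> * x0 ^ 5 = b01 \<beta> * x0 + 2 * b11 \<beta> * x1"
    and r11: "b11 \<alpha> * x0 ^ 5 = b11 \<beta> * y1"
    and r12: "b12 \<alpha> * x0 ^ 4 = b12 \<beta> * y1 + 2 * b14 \<beta> * y3"
    and r14: "b14 \<alpha> * x0\<^sup>2 = b14 \<beta> * y1"
  shows "L \<alpha> \<simeq>\<^sub>L L \<beta>"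
proof -
  \<comment> \<open>The images of \<open>e 2\<close> to \<open>e 6\<close> are forced by iterated
    right bracketing with \<open>f (e 0)\<close>; \<open>c\<close> collects the resulting
    coordinates 6 of those of \<open>e 2\<close> to \<open>e 5\<close>.\<close>
  define c where "c v = b11 \<beta> * y1 * x1 * v$2 - (b12 \<beta> * y1 + b14 \<beta> * y3) * x0 * x1 * v$3
      + y3 * x0 ^ 3 * v$4 - b14 \<beta> * y1 * x0 ^ 3 * x1 * v$5" for v :: "complex^7"
  define f :: "complex^7 \<Rightarrow> complex^7" where "f v = (\<chi> i.
      if i = 0 then x0 * v$0
      else if i = 1 then x1 * v$0 + y1 * v$1
      else if i = 2 then y1 * x0 * v$2
      else if i = 3 then y3 * v$1 + y1 * x0\<^sup>2 * v$3
      else if i = 4 then y3 * x0 * v$2 + y1 * x0 ^ 3 * v$4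
      else if i = 5 then y3 * x0\<^sup>2 * v$3 + y1 * x0 ^ 4 * v$5
      else c v + y1 * x0 ^ 5 * v$6)" for v
  have f_components:
    "f v $ 0 = x0 * v$0" "f v $ 1 = x1 * v$0 + y1 * v$1" "f v $ 2 = y1 * x0 * v$2"
    "f v $ 3 = y3 * v$1 + y1 * x0\<^sup>2 * v$3" "f v $ 4 = y3 * x0 * v$2 + y1 * x0 ^ 3 * v$4"
    "f v $ 5 = y3 * x0\<^sup>2 * v$3 + y1 * x0 ^ 4 * v$5" "f v $ 6 = c v + y1 * x0 ^ 5 * v$6" for v
    by (simp_all add: f_def)
  have lin: "Vector_Spaces.linear (*s) (*s) f"
    by unfold_locales (simp_all add: vec_eq_7 f_components c_def algebra_simps)
  then interpret f: Vector_Spaces.linear "(*s)" "(*s)" f .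
  \<comment> \<open>The matrix of \<open>f\<close> is lower triangular, with products of powers of
    \<open>x0\<close> and \<open>y1\<close> on the diagonal.\<close>
  have "v = 0" if "f v = 0" for v
    using that \<open>x0 \<noteq> 0\<close> \<open>y1 \<noteq> 0\<close> by (auto simp: vec_eq_7 f_components c_def)
  then have inj: "inj f"
    using f.inj_iff_eq_0 by blast
  then have bij: "bij f"
    using vec.linear_injective_imp_surjective[OF lin] by (simp add: bij_def)
  have hom: "f (L \<alpha> u v) = L \<beta> (f u) (f v)" for u v
  proof -
    have "f (L \<alpha> u v) $ 6 = L \<beta> (f u) (f v) $ 6"
    proof -
      \<comment> \<open>Grouped so that the left sides of the five relations appear verbatim, ready
        for rewriting.\<close>
      have "f (L \<alpha> u v) $ 6 = c (L \<alpha> u v) + y1 * x0 ^ 5 * (u$5 * v$0 - u$0 * v$5)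
          + (b00 \<alpha> * (y1 * x0 ^ 5)) * (u$0 * v$0) + y1 * (b01 \<alpha> * x0 ^ 5) * (u$0 * v$1)
          + y1 * (b11 \<alpha> * x0 ^ 5) * (u$1 * v$1)
          + y1 * x0 * (b12 \<alpha> * x0 ^ 4) * (u$1 * v$2 - u$2 * v$1)
          + y1 * x0 ^ 3 * (b14 \<alpha> * x0\<^sup>2) * (u$1 * v$4 - u$4 * v$1 - u$2 * v$3 + u$3 * v$2)"
        by (simp add: f_components L_components algebra_simps eval_nat_numeral)
      also have "\<dots> = L \<beta> (f u) (f v) $ 6"
        unfolding r00 r01 r11 r12 r14
        by (simp add: f_components L_components c_def algebra_simps eval_nat_numeral)
      finally show ?thesis .
    qed
    then show ?thesis
      by (simp add: vec_eq_7 f_components(1-6) L_components(1-6) algebra_simps eval_nat_numeral)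
  qed
  show ?thesis
    unfolding leibniz_isomorphic_def using leibniz_algebra_L lin bij hom by blast
qed

lemma complex_root_exists:
  assumes "n > 0"
  obtains z :: complex where "z ^ n = w"
proof (cases "w = 0")
  case True
  then show thesis using that[of 0] assms by simp
next
  case False
  then have "exp (Ln w / of_nat n) ^ n = w"
    using assms by (simp flip: exp_of_nat_mult)
  then show thesis by (rule that)
qed

text \<open>Supplies \<open>x0\<close>. One \<open>t\<close> can meet both conditions because 8 is
  prime to 3, so the eighth power permutes the cube roots of unity.\<close>

lemma exists_complex_cube_root_with_eighth_power:
  fixes r :: complex
  assumes "r \<noteq> 0" "D ^ 3 = r ^ 8 * E ^ 3"
  obtains t where "t ^ 3 = r" "D = t ^ 8 * E"
proof -
  obtain s where s: "s ^ 3 = r" using complex_root_exists[of 3 r] by auto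
  show thesis
  proof (cases "E = 0")
    case True
    then show thesis using assms s that[of s] by simp
  next
    case False
    define w where "w = D / (s ^ 8 * E)"
    have "s \<noteq> 0" using s assms by auto
    have "D ^ 3 = (s ^ 8 * E) ^ 3"
      using assms by (simp add: power_mult_distrib flip: s power_mult)
    then have w3: "w ^ 3 = 1"
      using \<open>s \<noteq> 0\<close> False by (simp add: w_def power_divide)
    \<comment> \<open>Since \<open>(w\<^sup>2)\<^sup>8 = w\<^sup>1\<^sup>6 = w\<close>, scaling \<open>s\<close> by \<open>w\<^sup>2\<close> corrects the eighth power.\<close>
    have "(w\<^sup>2) ^ 8 = (w ^ 3) ^ 5 * w" "(w\<^sup>2) ^ 3 = (w ^ 3)\<^sup>2"
      by (simp_all add: eval_nat_numeral)
    then have "(w\<^sup>2 * s) ^ 3 = r" "(w\<^sup>2 * s) ^ 8 = w * s ^ 8"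
      by (simp_all add: power_mult_distrib w3 s)
    moreover have "D = w * s ^ 8 * E"
      using \<open>s \<noteq> 0\<close> False by (simp add: w_def)
    ultimately show thesis using that[of "w\<^sup>2 * s"] by simp
  qed
qed

lemma invariant_eq_if_L_isomorphic:
  assumes "L \<alpha> \<simeq>\<^sub>L L \<beta>" and "b11 \<alpha> \<noteq> 0" "b11 \<beta> \<noteq> 0"
  shows "(b14 \<alpha> / b11 \<alpha>) ^ 8 * Delta \<alpha> ^ 3 = (b14 \<beta> / b11 \<beta>) ^ 8 * Delta \<beta> ^ 3"
proof -
  obtain x0 x1 y1 where x0: "x0 \<noteq> 0" and y1: "y1 \<noteq> 0"
    and r00: "b00 \<alpha> * (y1 * x0 ^ 5) = b00 \<beta> * x0\<^sup>2 + b01 \<beta> * x0 * x1 + b11 \<beta> * x1\<^sup>2"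
    and r01: "b01 \<alpha> * x0 ^ 5 = b01 \<beta> * x0 + 2 * b11 \<beta> * x1"
    and r11: "b11 \<alpha> * x0 ^ 5 = b11 \<beta> * y1"
    and r14: "b14 \<alpha> * x0\<^sup>2 = b14 \<beta> * y1"
    using L_isomorphic_imp_relations[OF assms(1)] by metis
  \<comment> \<open>Eliminates \<open>y1\<close> between \<open>r11\<close> and
    \<open>r14\<close>.\<close>
  have "y1 * x0\<^sup>2 * (b14 \<alpha> * b11 \<beta>) = (b14 \<alpha> * x0\<^sup>2) * (b11 \<beta> * y1)" by simp
  also have "\<dots> = y1 * x0\<^sup>2 * (x0 ^ 3 * b14 \<beta> * b11 \<alpha>)"
    unfolding r14 r11[symmetric] by (simp add: eval_nat_numeral)
  finally have "b14 \<alpha> * b11 \<beta> = x0 ^ 3 * b14 \<beta> * b11 \<alpha>"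
    using x0 y1 by simp
  then have ratio: "b14 \<alpha> / b11 \<alpha> = x0 ^ 3 * (b14 \<beta> / b11 \<beta>)"
    using assms by (simp add: field_simps)
  \<comment> \<open>\<open>Delta\<close> is the discriminant of the quadratic form given by
    coordinate 6 of \<open>[v, v]\<close> on the span of \<open>e 0\<close>, \<open>e 1\<close>, so
    the shear \<open>x1\<close> cancels.\<close>
  have "y1 * x0 ^ 10 * Delta \<alpha>
      = y1 * (b01 \<alpha> * x0 ^ 5)\<^sup>2 - 4 * (b00 \<alpha> * (y1 * x0 ^ 5)) * (b11 \<alpha> * x0 ^ 5)"
    by (simp add: Delta_def algebra_simps eval_nat_numeral)
  also have "\<dots> = y1 * x0\<^sup>2 * Delta \<beta>"
    unfolding r00 r01 r11 by (simp add: Delta_def algebra_simps eval_nat_numeral)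
  finally have "y1 * x0\<^sup>2 * (x0 ^ 8 * Delta \<alpha>) = y1 * x0\<^sup>2 * Delta \<beta>"
    by (simp add: eval_nat_numeral mult.assoc)
  then have "Delta \<beta> = x0 ^ 8 * Delta \<alpha>"
    using x0 y1 by simp
  then show ?thesis
    unfolding ratio by (simp add: power_mult_distrib power_divide flip: power_mult)
qed

lemma L_isomorphic_if_invariant_eq:
  assumes nz: "b11 \<alpha> \<noteq> 0" "b11 \<beta> \<noteq> 0" "b14 \<alpha> \<noteq> 0" "b14 \<beta> \<noteq> 0"
    and eq: "(b14 \<alpha> / b11 \<alpha>) ^ 8 * Delta \<alpha> ^ 3 = (b14 \<beta> / b11 \<beta>) ^ 8 * Delta \<beta> ^ 3"
  shows "L \<alpha> \<simeq>\<^sub>L L \<beta>"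
proof -
  define r where "r = (b14 \<alpha> / b11 \<alpha>) / (b14 \<beta> / b11 \<beta>)"
  have r0: "r \<noteq> 0" using nz by (simp add: r_def)
  have "Delta \<beta> ^ 3 = r ^ 8 * Delta \<alpha> ^ 3"
    using eq nz by (simp add: r_def field_simps)
  then obtain x0 where x0_3: "x0 ^ 3 = r" and D: "Delta \<beta> = x0 ^ 8 * Delta \<alpha>"
    using exists_complex_cube_root_with_eighth_power[OF r0] by blast
  have x0: "x0 \<noteq> 0" using x0_3 r0 by auto
  \<comment> \<open>\<open>y1\<close>, \<open>x1\<close>, \<open>y3\<close> solve
    \<open>r11\<close>, \<open>r01\<close>, \<open>r12\<close> in turn, each linear in its unknown.
    Then \<open>r14\<close> follows from \<open>x0_3\<close>, and \<open>r00\<close> from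
    \<open>D\<close>.\<close>
  define y1 where "y1 = b11 \<alpha> * x0 ^ 5 / b11 \<beta>"
  define x1 where "x1 = (b01 \<alpha> * x0 ^ 5 - b01 \<beta> * x0) / (2 * b11 \<beta>)"
  define y3 where "y3 = (b12 \<alpha> * x0 ^ 4 - b12 \<beta> * y1) / (2 * b14 \<beta>)"
  have y1: "y1 \<noteq> 0" using x0 nz by (simp add: y1_def)
  have r11: "b11 \<alpha> * x0 ^ 5 = b11 \<beta> * y1" using nz by (simp add: y1_def)
  have r01: "b01 \<alpha> * x0 ^ 5 = b01 \<beta> * x0 + 2 * b11 \<beta> * x1" using nz by (simp add: x1_def)
  have r12: "b12 \<alpha> * x0 ^ 4 = b12 \<beta> * y1 + 2 * b14 \<beta> * y3" using nz by (simp add: y3_def)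
  have "b14 \<beta> * y1 = (b14 \<beta> * b11 \<alpha> / b11 \<beta> * x0 ^ 3) * x0\<^sup>2"
    by (simp add: y1_def eval_nat_numeral)
  also have "\<dots> = b14 \<alpha> * x0\<^sup>2"
    unfolding x0_3 r_def using nz by simp
  finally have r14: "b14 \<alpha> * x0\<^sup>2 = b14 \<beta> * y1" ..
  \<comment> \<open>The factor \<open>4 * b11 \<beta>\<close> completes the square in
    \<open>x1\<close>, turning \<open>r00\<close> into an identity between discriminants.\<close>
  have "4 * b11 \<beta> * (b00 \<alpha> * (y1 * x0 ^ 5)) = 4 * b00 \<alpha> * (b11 \<beta> * y1) * x0 ^ 5"
    by simp
  also have "\<dots> = (b01 \<alpha> * x0 ^ 5)\<^sup>2 - x0\<^sup>2 * (x0 ^ 8 * Delta \<alpha>)"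
    unfolding r11[symmetric] by (simp add: Delta_def algebra_simps eval_nat_numeral)
  also have "\<dots> = 4 * b11 \<beta> * (b00 \<beta> * x0\<^sup>2 + b01 \<beta> * x0 * x1 + b11 \<beta> * x1\<^sup>2)"
    unfolding r01 D[symmetric] by (simp add: Delta_def algebra_simps eval_nat_numeral)
  finally have r00: "b00 \<alpha> * (y1 * x0 ^ 5) = b00 \<beta> * x0\<^sup>2 + b01 \<beta> * x0 * x1 + b11 \<beta> * x1\<^sup>2"
    using nz by simp
  show ?thesis
    by (rule L_isomorphic_if_relations[OF x0 y1 r00 r01 r11 r12 r14])
qed

text \<open>For the normal form the ratio is 1 and \<open>Delta\<close> is \<open>- 4 * l\<close>,
  so the invariant is \<open>(- 4 * l) ^ 3\<close>, not \<open>l\<close> itself.\<close>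

lemma exists_normal_form_invariant:
  obtains l where "(b14 (CE_Param l 0 1 0 1) / b11 (CE_Param l 0 1 0 1)) ^ 8
    * Delta (CE_Param l 0 1 0 1) ^ 3 = w"
proof -
  obtain z :: complex where "z ^ 3 = w" using complex_root_exists[of 3 w] by auto
  then show thesis using that[of "- z / 4"] by (simp add: Delta_def)
qed

theorem proposition3p9:
  "(\<forall>\<alpha> \<alpha>'. L \<alpha> \<in> U1 \<longrightarrow> L \<alpha>' \<in> U1 \<longrightarrow>
      (L \<alpha> \<simeq>\<^sub>L L \<alpha>' \<longleftrightarrow>
       (b14 \<alpha> / b11 \<alpha>) ^ 8 * Delta \<alpha> ^ 3 = (b14 \<alpha>' / b11 \<alpha>') ^ 8 * Delta \<alpha>' ^ 3)) \<and>
   (\<forall>l::complex. \<exists>\<alpha>. L \<alpha> \<in> U1 \<and> (b14 \<alpha> / b11 \<alpha>) ^ 8 * Delta \<alpha> ^ 3 = l) \<and>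
   (\<forall>l::complex. L (CE_Param l 0 1 0 1) \<in> U1) \<and>
   (\<forall>A\<in>U1. \<exists>l::complex. A \<simeq>\<^sub>L L (CE_Param l 0 1 0 1))"
proof (intro conjI allI impI ballI)
  fix \<alpha> \<alpha>' assume "L \<alpha> \<in> U1" "L \<alpha>' \<in> U1"
  then show "L \<alpha> \<simeq>\<^sub>L L \<alpha>' \<longleftrightarrow>
      (b14 \<alpha> / b11 \<alpha>) ^ 8 * Delta \<alpha> ^ 3 = (b14 \<alpha>' / b11 \<alpha>') ^ 8 * Delta \<alpha>' ^ 3"
    using invariant_eq_if_L_isomorphic L_isomorphic_if_invariant_eq L_in_U1_iff by metis
next
  show normal_form: "L (CE_Param l 0 1 0 1) \<in> U1" for l
    by (simp add: L_in_U1_iff)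
  show "\<exists>\<alpha>. L \<alpha> \<in> U1 \<and> (b14 \<alpha> / b11 \<alpha>) ^ 8 * Delta \<alpha> ^ 3 = l" for l
    using exists_normal_form_invariant[of l] normal_form by metis
  fix A assume "A \<in> U1"
  then obtain \<alpha> where A: "A = L \<alpha>" and nz: "b11 \<alpha> \<noteq> 0" "b14 \<alpha> \<noteq> 0"
    by (auto simp: U1_def)
  obtain l where "(b14 (CE_Param l 0 1 0 1) / b11 (CE_Param l 0 1 0 1)) ^ 8
      * Delta (CE_Param l 0 1 0 1) ^ 3 = (b14 \<alpha> / b11 \<alpha>) ^ 8 * Delta \<alpha> ^ 3"
    by (rule exists_normal_form_invariant)
  then show "\<exists>l. A \<simeq>\<^sub>L L (CE_Param l 0 1 0 1)"
    unfolding A using nz by (intro exI[of _ l] L_isomorphic_if_invariant_eq) simp_all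
qed

end
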